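(* For every $n \in \mathbb{N}$, the random sets $\mathbf{S}_n$ and $\mathbf{T}_n$ have the same distribution, that is, $\mathbb{P}\{\mathbf{S}_n = S\} = \mathbb{P}\{\mathbf{T}_n = S\}$ for every $S \subseteq [n-1]$. In particular, for $0 \le m \le n-1$, \[ \mathbb{P}\{\#\mathbf{S}_n = m\} = \mathbb{P}\{\#\mathbf{T}_n = m\} = \left(\frac{1}{m!} \sum_{k=0}^{n-m} \frac{(-1)^k}{k!}\right)\frac{n-m}{n} + \left(\frac{1}{(m+1)!} \sum_{k=0}^{n-m-1} \frac{(-1)^k}{k!}\right)\frac{m+1}{n}. \]
   Context: $\mathbb{N} = \{1,2,\ldots\}$. For $n \in \mathbb{N}$, $[n] := \{1,2,\ldots,n\}$ (and $[0] = \emptyset$), and $\mathfrak{S}_n$ is the set of all permutations of $[n]$. $\Pi_n$ denotes a random permutation uniformly distributed on $\mathfrak{S}_n$. Define the random subsets of $[n-1]$ \[ \mathbf{S}_n := \{k \in [n-1] : \Pi_n(k+1) = \Pi_n(k)+1\}, \qquad \mathbf{T}_n := \{k \in [n-1] : \Pi_n(k) = k\}. \] $\#A$ denotes the cardinality of a finite set $A$. *)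

theory Defs
  imports "HOL-Probability.Probability" "HOL-Combinatorics.Permutations"
begin

definition perms :: "nat \<Rightarrow> (nat \<Rightarrow> nat) set" where
  "perms n = {p. p permutes {1..n}}"

definition uniform_random_perm :: "nat \<Rightarrow> 'a measure \<Rightarrow> ('a \<Rightarrow> nat \<Rightarrow> nat) \<Rightarrow> bool" where
  "uniform_random_perm n M X \<longleftrightarrow>
     prob_space M \<and>
     X \<in> measurable M (count_space (perms n)) \<and>
     distr M (count_space (perms n)) X = uniform_count_measure (perms n)"

definition succ_set :: "nat \<Rightarrow> (nat \<Rightarrow> nat) \<Rightarrow> nat set" where
  "succ_set n p = {k \<in> {1..n - 1}. p (k + 1) = p k + 1}"

text \<open>A fixed point at \<open>n\<close> itself is deliberately not recorded.\<close>

definition fix_set :: "nat \<Rightarrow> (nat \<Rightarrow> nat) \<Rightarrow> nat set" where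
  "fix_set n p = {k \<in> {1..n - 1}. p k = k}"

end

theory Submission
  imports Defs
begin

text \<open>
  For \<open>S \<subseteq> {1..n - 1}\<close>, exactly \<open>(n - |S|)!\<close> permutations fix every element of \<open>S\<close>, and also
  exactly \<open>(n - |S|)!\<close> permutations have a succession at every element of \<open>S\<close>: if \<open>k = Max S\<close>,
  deleting position \<open>k + 1\<close> together with its value \<open>p k + 1\<close> is a bijection onto the permutations
  of \<open>{1..n - 1}\<close> with successions at \<open>S - {k}\<close>. By inclusion-exclusion the numbers of elements whose
  set contains \<open>S\<close> determine the numbers of those whose set equals \<open>S\<close>, so both random sets have
  the same law, and summing the inclusion-exclusion formula over \<open>|S| = m\<close> gives the law of the
  cardinality.
\<close>

section \<open>Inclusion-exclusion from superset counts\<close>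

text \<open>Keeping the forbidden set \<open>F\<close> separate from \<open>S\<close> makes an
  induction on \<open>F\<close> possible: the elements that avoid \<open>F\<close> split by whether
  \<open>h x\<close> contains the new point \<open>f\<close>. The count is thus a difference of two
  counts for \<open>F\<close>, and Pascal's rule merges the two sums.\<close>

lemma card_separating_eq:
  fixes h :: "'x \<Rightarrow> 'u set" and a :: "nat \<Rightarrow> nat"
  assumes "finite X" "finite U"
    and a: "\<And>S. S \<subseteq> U \<Longrightarrow> card {x \<in> X. S \<subseteq> h x} = a (card S)"
    and "F \<subseteq> U" "S \<subseteq> U" "S \<inter> F = {}"
  shows "int (card {x \<in> X. S \<subseteq> h x \<and> h x \<inter> F = {}}) =
    (\<Sum>j\<le>card F. (-1) ^ j * int (card F choose j) * int (a (card S + j)))"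
proof -
  have "finite F" using assms(2,4) by (rule finite_subset[rotated])
  then show ?thesis using assms(4-6)
  proof (induction F arbitrary: S rule: finite_induct)
    case empty
    then show ?case using a[of S] by simp
  next
    case (insert f F)
    let ?N = "\<lambda>S F. {x \<in> X. S \<subseteq> h x \<and> h x \<inter> F = {}}"
    let ?r = "card F" and ?s = "card S"
    have finS: "finite S" using insert.prems(2) assms(2) by (rule finite_subset)
    have "card (?N S F) = card (?N S (insert f F)) + card (?N (insert f S) F)"
      by (subst card_Un_disjoint[symmetric]) (use assms(1) in \<open>auto intro!: arg_cong[where f = card]\<close>)
    then have "int (card (?N S (insert f F))) = int (card (?N S F)) - int (card (?N (insert f S) F))"
      by simp
    also have "\<dots> = (\<Sum>j\<le>?r. (-1) ^ j * int (?r choose j) * int (a (?s + j)))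
        - (\<Sum>j\<le>?r. (-1) ^ j * int (?r choose j) * int (a (Suc ?s + j)))"
      using insert finS by (subst (1 2) insert.IH) auto
    \<comment> \<open>The added summand vanishes because \<open>?r choose Suc ?r\<close> is zero; it
      aligns the range with that of the second sum shifted by one.\<close>
    also have "(\<Sum>j\<le>?r. (-1) ^ j * int (?r choose j) * int (a (?s + j)))
        = (\<Sum>j\<le>Suc ?r. (-1) ^ j * int (?r choose j) * int (a (?s + j)))"
      by (simp add: binomial_eq_0)
    also have "\<dots> - (\<Sum>j\<le>?r. (-1) ^ j * int (?r choose j) * int (a (Suc ?s + j)))
        = (\<Sum>j\<le>Suc ?r. (-1) ^ j * int (Suc ?r choose j) * int (a (?s + j)))"
      by (simp add: sum.atMost_Suc_shift algebra_simps sum.distrib sum_negf sum_subtractf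
          del: sum.atMost_Suc)
    finally show ?case using insert by simp
  qed
qed

text \<open>This is the case \<open>F = U - S\<close>: for subsets of \<open>U\<close>, containing
  \<open>S\<close> and avoiding \<open>U - S\<close> amounts to being \<open>S\<close>.\<close>

lemma card_vimage_eq:
  fixes h :: "'x \<Rightarrow> 'u set" and a :: "nat \<Rightarrow> nat"
  assumes "finite X" "finite U"
    and "\<And>S. S \<subseteq> U \<Longrightarrow> card {x \<in> X. S \<subseteq> h x} = a (card S)"
    and "\<And>x. x \<in> X \<Longrightarrow> h x \<subseteq> U" "S \<subseteq> U"
  shows "int (card {x \<in> X. h x = S}) =
    (\<Sum>j\<le>card U - card S. (-1) ^ j * int (card U - card S choose j) * int (a (card S + j)))"
proof -
  have "{x \<in> X. h x = S} = {x \<in> X. S \<subseteq> h x \<and> h x \<inter> (U - S) = {}}"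
    using assms(4,5) by blast
  moreover have "card (U - S) = card U - card S"
    using assms(2,5) by (meson card_Diff_subset finite_subset)
  ultimately show ?thesis
    using card_separating_eq[OF assms(1-3), of "U - S" S] assms(5) by auto
qed

section \<open>Permutations with prescribed fixed points\<close>

lemma finite_perms: "finite (perms n)"
  unfolding perms_def by (simp add: finite_permutations)

lemma card_perms: "card (perms n) = fact n"
  unfolding perms_def by (simp add: card_permutations)

text \<open>Permutations of \<open>{1..n}\<close> that fix \<open>S\<close> pointwise are exactly
  the permutations of the complement of \<open>S\<close>.\<close>

lemma card_fix_superset:
  assumes "S \<subseteq> {1..n - 1}"
  shows "card {p \<in> perms n. S \<subseteq> fix_set n p} = fact (n - card S)"
proof -
  have S: "S \<subseteq> {1..n}" using assms by (rule order_trans) simp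
  have "{p \<in> perms n. S \<subseteq> fix_set n p} = {p. p permutes ({1..n} - S)}"
  proof safe
    fix p assume "p \<in> perms n" "S \<subseteq> fix_set n p"
    then have "p permutes {1..n}" "\<forall>x\<in>S. p x = x"
      unfolding perms_def fix_set_def by blast+
    then show "p permutes ({1..n} - S)"
      by (auto intro: permutes_superset)
  next
    fix p assume p: "p permutes ({1..n} - S)"
    then show "p \<in> perms n"
      unfolding perms_def by (simp add: permutes_subset[OF p])
    fix x assume "x \<in> S"
    then show "x \<in> fix_set n p"
      using assms permutes_not_in[OF p] unfolding fix_set_def by auto
  qed
  moreover have "card ({1..n} - S) = n - card S"
    using S by (simp add: card_Diff_subset finite_subset[OF S])
  ultimately show ?thesis by (simp add: card_permutations)
qed

section \<open>Permutations with prescribed successions\<close>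

text \<open>
  When \<open>p (k + 1) = p k + 1\<close>, \<open>collapse k p\<close> is \<open>p\<close> with position \<open>k + 1\<close> and value \<open>p k + 1\<close> removed and
  the gaps closed; \<open>expand k\<close> is the inverse operation. Neither mentions \<open>n\<close>: as \<open>p\<close> is the
  identity beyond its support, shifting both position and value by one preserves this.
\<close>

definition collapse :: "nat \<Rightarrow> (nat \<Rightarrow> nat) \<Rightarrow> nat \<Rightarrow> nat" where
  "collapse k p i = (let y = p (if i \<le> k then i else i + 1) in if y \<le> p k then y else y - 1)"

definition expand :: "nat \<Rightarrow> (nat \<Rightarrow> nat) \<Rightarrow> nat \<Rightarrow> nat" where
  "expand k q i = (if i = k + 1 then q k + 1
     else let y = q (if i \<le> k then i else i - 1) in if y \<le> q k then y else y + 1)"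

text \<open>The value \<open>p k + 1\<close> occurs only at the skipped position
  \<open>k + 1\<close>, so closing the gap merges no two values. An injective map of the finite set
  \<open>{1..n}\<close> into itself is bijective there.\<close>

lemma collapse_perms:
  assumes p: "p \<in> perms (Suc n)" and k: "k \<in> {1..n}" and pk: "p (k + 1) = p k + 1"
  shows "collapse k p \<in> perms n"
proof -
  have pp: "p permutes {1..Suc n}" using p by (simp add: perms_def)
  have inj: "p x = p y \<longleftrightarrow> x = y" for x y using permutes_inj[OF pp] by (auto dest: injD)
  have rng: "p x \<in> {1..Suc n} \<longleftrightarrow> x \<in> {1..Suc n}" for x using permutes_in_image[OF pp] .
  have ge: "x > Suc n \<Longrightarrow> p x = x" for x using permutes_not_in[OF pp] by simp
  have z: "p 0 = 0" using permutes_not_in[OF pp] by simp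
  \<comment> \<open>The upper bound is \<open>n\<close> rather than \<open>Suc n\<close> because
    \<open>p k + 1\<close> is itself a value of \<open>p\<close> on the support.\<close>
  have vk: "1 \<le> p k" "p k \<le> n" using rng[of k] rng[of "k+1"] k pk by auto
  have ne: "p x \<noteq> p k + 1" if "x \<noteq> k + 1" for x using inj[of x "k+1"] pk that by auto
  have "inj (collapse k p)"
  proof (rule injI)
    fix x y assume eq: "collapse k p x = collapse k p y"
    let ?x = "if x \<le> k then x else x + 1" and ?y = "if y \<le> k then y else y + 1"
    have "p ?x \<noteq> p k + 1" "p ?y \<noteq> p k + 1" by (rule ne; simp)+
    then have "p ?x = p ?y" using eq unfolding collapse_def Let_def by (simp split: if_splits)
    then have "?x = ?y" by (simp only: inj)
    then show "x = y" by (simp split: if_splits)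
  qed
  moreover have "collapse k p x \<in> {1..n}" if "x \<in> {1..n}" for x
  proof -
    let ?x = "if x \<le> k then x else x + 1"
    have "p ?x \<in> {1..Suc n}" using rng[of ?x] that by auto
    then show ?thesis unfolding collapse_def Let_def using vk by auto
  qed
  then have "collapse k p ` {1..n} \<subseteq> {1..n}" by blast
  ultimately have "bij_betw (collapse k p) {1..n} {1..n}"
    by (metis bij_betw_def endo_inj_surj finite_atLeastAtMost inj_on_subset subset_UNIV)
  moreover have "collapse k p x = x" if "x \<notin> {1..n}" for x
  proof (cases "x = 0")
    case True
    then show ?thesis using z by (simp add: collapse_def)
  next
    case False
    then have "x > n" using that by auto
    then show ?thesis using ge[of "x + 1"] vk k by (simp add: collapse_def)
  qed
  ultimately show ?thesis unfolding perms_def by (blast intro: bij_imp_permutes)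
qed

lemma expand_perms:
  assumes q: "q \<in> perms n" and k: "k \<in> {1..n}"
  shows "expand k q \<in> perms (Suc n)"
proof -
  have pp: "q permutes {1..n}" using q by (simp add: perms_def)
  have inj: "q x = q y \<longleftrightarrow> x = y" for x y using permutes_inj[OF pp] by (auto dest: injD)
  have rng: "q x \<in> {1..n} \<longleftrightarrow> x \<in> {1..n}" for x using permutes_in_image[OF pp] .
  have ge: "x > n \<Longrightarrow> q x = x" for x using permutes_not_in[OF pp] by simp
  have z: "q 0 = 0" using permutes_not_in[OF pp] by simp
  have vk: "1 \<le> q k" "q k \<le> n" using rng[of k] k by auto
  have "inj (expand k q)"
  proof (rule injI)
    fix x y assume eq: "expand k q x = expand k q y"
    let ?x = "if x \<le> k then x else x - 1" and ?y = "if y \<le> k then y else y - 1"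
    \<comment> \<open>The mixed cases are contradictory: away from \<open>k + 1\<close>, the values
      of \<open>expand k q\<close> are at most \<open>q k\<close> or at least
      \<open>q k + 2\<close>.\<close>
    consider "x = k + 1" "y = k + 1" | "x = k + 1" "y \<noteq> k + 1" | "x \<noteq> k + 1" "y = k + 1"
      | "x \<noteq> k + 1" "y \<noteq> k + 1" by blast
    then show "x = y"
    proof cases
      case 4
      then have "q ?x = q ?y" using eq unfolding expand_def Let_def by (simp split: if_splits)
      then have "?x = ?y" by (simp only: inj)
      then show ?thesis using 4 by (simp split: if_splits)
    qed (use eq in \<open>simp_all add: expand_def Let_def split: if_splits\<close>)
  qed
  moreover have "expand k q x \<in> {1..Suc n}" if "x \<in> {1..Suc n}" for x
  proof (cases "x = k + 1")
    case True
    then show ?thesis using vk by (simp add: expand_def)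
  next
    case False
    let ?x = "if x \<le> k then x else x - 1"
    have "q ?x \<in> {1..n}" using rng[of ?x] that False k by auto
    then show ?thesis unfolding expand_def Let_def using vk False by auto
  qed
  then have "expand k q ` {1..Suc n} \<subseteq> {1..Suc n}" by blast
  ultimately have "bij_betw (expand k q) {1..Suc n} {1..Suc n}"
    by (metis bij_betw_def endo_inj_surj finite_atLeastAtMost inj_on_subset subset_UNIV)
  moreover have "expand k q x = x" if "x \<notin> {1..Suc n}" for x
  proof (cases "x = 0")
    case True
    then show ?thesis using z by (simp add: expand_def)
  next
    case False
    then have "x > Suc n" using that by auto
    then have "q (x - 1) = x - 1" using ge[of "x - 1"] by simp
    then show ?thesis using \<open>x > Suc n\<close> vk k by (simp add: expand_def Let_def)
  qed
  ultimately show ?thesis unfolding perms_def by (blast intro: bij_imp_permutes)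
qed

text \<open>Injectivity keeps \<open>p k + 1\<close> away from all positions other than
  \<open>k + 1\<close>, so closing the gap loses no information there; the succession at
  \<open>k\<close> restores the deleted entry.\<close>

lemma expand_collapse:
  assumes p: "inj p" and pk: "p (k + 1) = p k + 1"
  shows "expand k (collapse k p) = p"
proof
  fix i
  let ?i = "if i \<le> k then i else i - 1"
  have v: "collapse k p k = p k" by (simp add: collapse_def)
  show "expand k (collapse k p) i = p i"
  proof (cases "i = k + 1")
    case True
    then show ?thesis using v pk by (simp add: expand_def)
  next
    case False
    then have "p i \<noteq> p k + 1" using p pk by (metis injD)
    moreover have "collapse k p ?i = (if p i \<le> p k then p i else p i - 1)"
      using False by (auto simp: collapse_def Let_def)
    ultimately show ?thesis using False v unfolding expand_def Let_def by auto
  qed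
qed

lemma collapse_expand: "collapse k (expand k q) = q"
proof
  fix i
  have "expand k q k = q k" by (simp add: expand_def)
  moreover have "expand k q (if i \<le> k then i else i + 1) = (if q i \<le> q k then q i else q i + 1)"
    by (auto simp: expand_def Let_def)
  ultimately show "collapse k (expand k q) i = q i" unfolding collapse_def Let_def by auto
qed

text \<open>Since \<open>j + 1 \<le> k\<close>, neither position moves. Closing the gap could create
  a succession only from \<open>p k\<close> to \<open>p k + 2\<close>, and destroy one only if it
  involves the value \<open>p k + 1\<close>; injectivity excludes both, as \<open>p k\<close> and
  \<open>p k + 1\<close> sit at \<open>k\<close> and \<open>k + 1\<close>.\<close>

lemma succession_collapse_iff:
  assumes "inj p" "p (k + 1) = p k + 1" "j < k"
  shows "collapse k p (j + 1) = collapse k p j + 1 \<longleftrightarrow> p (j + 1) = p j + 1"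
proof -
  have "p j \<noteq> p k" "p j \<noteq> p k + 1" "p (j + 1) \<noteq> p k + 1"
    using assms by (metis injD less_irrefl less_add_one less_trans Suc_eq_plus1 Suc_inject)+
  then show ?thesis using assms(3) unfolding collapse_def Let_def by auto
qed

text \<open>Adding the largest element \<open>k\<close> last puts all other required successions
  below \<open>k\<close>, where collapsing respects them. Each step lowers \<open>n\<close> and the
  size of \<open>S\<close> together, so \<open>n\<close> must vary in the induction.\<close>

lemma card_succ_superset:
  assumes "S \<subseteq> {1..n - 1}"
  shows "card {p \<in> perms n. S \<subseteq> succ_set n p} = fact (n - card S)"
proof -
  have "finite S" using assms by (rule finite_subset) simp
  then show ?thesis using assms
  proof (induction S arbitrary: n rule: finite_linorder_max_induct)
    case empty
    then show ?case by (simp add: card_perms)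
  next
    case (insert k S)
    then obtain m where n: "n = Suc m" by (cases n) auto
    have k: "k \<in> {1..m}" using insert.prems n by auto
    \<comment> \<open>The elements of \<open>S\<close> lie strictly below \<open>k \<le> m\<close>,
      which gives the smaller bound.\<close>
    have S: "S \<subseteq> {1..m - 1}" using insert k by fastforce
    let ?A = "{p \<in> perms n. insert k S \<subseteq> succ_set n p}"
    let ?B = "{p \<in> perms m. S \<subseteq> succ_set m p}"
    have inj: "inj p" if "p \<in> perms i" for p i
      using that unfolding perms_def by (auto dest: permutes_inj)
    have A: "p \<in> ?A \<longleftrightarrow> p \<in> perms n \<and> p (k + 1) = p k + 1 \<and> (\<forall>j\<in>S. p (j + 1) = p j + 1)" for p
      using insert.prems unfolding succ_set_def by auto
    have B: "p \<in> ?B \<longleftrightarrow> p \<in> perms m \<and> (\<forall>j\<in>S. p (j + 1) = p j + 1)" for p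
      using S unfolding succ_set_def by auto
    have "bij_betw (collapse k) ?A ?B"
    proof (rule bij_betw_byWitness[where f' = "expand k"])
      show "\<forall>p\<in>?A. expand k (collapse k p) = p"
      proof
        fix p assume "p \<in> ?A"
        then have "p \<in> perms n" "p (k + 1) = p k + 1" unfolding A by blast+
        then show "expand k (collapse k p) = p" by (intro expand_collapse inj)
      qed
      show "\<forall>q\<in>?B. collapse k (expand k q) = q"
        by (simp add: collapse_expand)
      show "collapse k ` ?A \<subseteq> ?B"
      proof (rule image_subsetI)
        fix p assume "p \<in> ?A"
        then have p: "p \<in> perms n" "p (k + 1) = p k + 1" "\<forall>j\<in>S. p (j + 1) = p j + 1"
          unfolding A by blast+
        have "collapse k p \<in> perms m" using collapse_perms k p(1,2) n by simp
        then show "collapse k p \<in> ?B"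
          unfolding B using succession_collapse_iff[OF inj[OF p(1)] p(2)] p(3) insert.hyps(2) by simp
      qed
      show "expand k ` ?B \<subseteq> ?A"
      proof (rule image_subsetI)
        fix q assume "q \<in> ?B"
        then have q: "q \<in> perms m" "\<forall>j\<in>S. q (j + 1) = q j + 1"
          unfolding B by blast+
        have e: "expand k q \<in> perms n" using expand_perms[OF q(1) k] n by simp
        have ek: "expand k q (k + 1) = expand k q k + 1" by (simp add: expand_def)
        \<comment> \<open>The equivalence is applied to \<open>expand k q\<close>, whose collapse is
          \<open>q\<close>.\<close>
        show "expand k q \<in> ?A"
          unfolding A using e ek q(2) insert.hyps succession_collapse_iff[OF inj[OF e] ek]
          by (simp add: collapse_expand)
      qed
    qed
    then have "card ?A = card ?B" by (rule bij_betw_same_card)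
    also have "\<dots> = fact (m - card S)" by (rule insert.IH[OF S])
    also have "m - card S = n - card (insert k S)" using n insert.hyps by auto
    finally show ?case .
  qed
qed

section \<open>Equality of the exact counts\<close>

lemma fix_set_subset: "fix_set n p \<subseteq> {1..n - 1}"
  unfolding fix_set_def by blast

lemma succ_set_subset: "succ_set n p \<subseteq> {1..n - 1}"
  unfolding succ_set_def by blast

text \<open>Stated for a general \<open>h\<close> so that \<open>fix_set\<close> and
  \<open>succ_set\<close> receive literally the same right-hand side.\<close>

lemma card_perms_vimage_eq:
  assumes sup: "\<And>T. T \<subseteq> {1..n - 1} \<Longrightarrow> card {p \<in> perms n. T \<subseteq> h p} = fact (n - card T)"
    and sub: "\<And>p. h p \<subseteq> {1..n - 1}" and "S \<subseteq> {1..n - 1}"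
  shows "int (card {p \<in> perms n. h p = S}) =
    (\<Sum>j\<le>n - 1 - card S. (-1) ^ j * int (n - 1 - card S choose j) * fact (n - (card S + j)))"
proof -
  have "int (card {p \<in> perms n. h p = S}) =
      (\<Sum>j\<le>card {1..n - 1} - card S. (-1) ^ j * int (card {1..n - 1} - card S choose j)
        * int (fact (n - (card S + j))))"
    by (rule card_vimage_eq[where h = h and a = "\<lambda>s. fact (n - s)"])
      (rule finite_perms finite_atLeastAtMost sup sub assms(3) | assumption)+
  then show ?thesis by (simp only: card_atLeastAtMost diff_Suc_1 of_nat_fact)
qed

lemma card_fix_set_eq:
  assumes "S \<subseteq> {1..n - 1}"
  shows "int (card {p \<in> perms n. fix_set n p = S}) =
    (\<Sum>j\<le>n - 1 - card S. (-1) ^ j * int (n - 1 - card S choose j) * fact (n - (card S + j)))"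
  by (intro card_perms_vimage_eq card_fix_superset fix_set_subset assms)

lemma card_succ_set_eq:
  assumes "S \<subseteq> {1..n - 1}"
  shows "int (card {p \<in> perms n. succ_set n p = S}) =
    (\<Sum>j\<le>n - 1 - card S. (-1) ^ j * int (n - 1 - card S choose j) * fact (n - (card S + j)))"
  by (intro card_perms_vimage_eq card_succ_superset succ_set_subset assms)

lemma card_succ_set_eq_card_fix_set:
  assumes "S \<subseteq> {1..n - 1}"
  shows "card {p \<in> perms n. succ_set n p = S} = card {p \<in> perms n. fix_set n p = S}"
proof -
  have "int (card {p \<in> perms n. succ_set n p = S}) = int (card {p \<in> perms n. fix_set n p = S})"
    by (simp only: card_succ_set_eq[OF assms] card_fix_set_eq[OF assms])
  then show ?thesis by (simp only: of_nat_eq_iff)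
qed

section \<open>Counting by cardinality\<close>

lemma card_card_vimage_eq:
  fixes h :: "'x \<Rightarrow> 'u set"
  assumes "finite X" "finite U" "\<And>x. x \<in> X \<Longrightarrow> h x \<subseteq> U"
  shows "card {x \<in> X. card (h x) = m} =
    (\<Sum>S \<in> {S. S \<subseteq> U \<and> card S = m}. card {x \<in> X. h x = S})"
proof -
  have "{x \<in> X. card (h x) = m} = (\<Union>S \<in> {S. S \<subseteq> U \<and> card S = m}. {x \<in> X. h x = S})"
    using assms(3) by auto
  then show ?thesis
    using assms(1,2) by (subst card_UN_disjoint[symmetric]) auto
qed

text \<open>Turns the inclusion-exclusion sum into the two truncated exponential series of the final
  formula. The source is the recurrence \<open>t j = - (j + 1) * t (j + 1)\<close> for the terms
  \<open>t j = (-1) ^ j / fact j\<close>.\<close>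

lemma sum_alternating_inverse_fact:
  "(\<Sum>j\<le>r. (-1) ^ j / fact j * (real r + 1 - real j)) =
    (real r + 1) * (\<Sum>k\<le>Suc r. (-1) ^ k / fact k) + (\<Sum>k\<le>r. (-1) ^ k / fact k)"
proof (induction r)
  case (Suc r)
  define t :: "nat \<Rightarrow> real" where "t j = (-1) ^ j / fact j" for j
  have t: "t (Suc r) = - (real r + 2) * t (Suc (Suc r))"
    unfolding t_def fact_Suc[of "Suc r"]
    by (simp add: divide_simps del: fact_Suc) (simp add: algebra_simps)
  have IH: "(\<Sum>j\<le>r. t j * (real r + 1 - real j)) = (real r + 1) * sum t {..Suc r} + sum t {..r}"
    using Suc.IH unfolding t_def .
  have "(\<Sum>j\<le>r. t j * (real (Suc r) + 1 - real j)) =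
      (\<Sum>j\<le>r. t j * (real r + 1 - real j)) + sum t {..r}"
    unfolding sum.distrib[symmetric] by (rule sum.cong) (simp_all add: algebra_simps)
  \<comment> \<open>The new summand has weight 1, so it extends \<open>sum t {..r}\<close> to
    \<open>sum t {..Suc r}\<close>.\<close>
  then have "(\<Sum>j\<le>Suc r. t j * (real (Suc r) + 1 - real j)) =
      (\<Sum>j\<le>r. t j * (real r + 1 - real j)) + sum t {..Suc r}"
    by simp
  also have "\<dots> = (real (Suc r) + 1) * sum t {..Suc (Suc r)} + sum t {..Suc r}"
    unfolding IH using t by (simp add: algebra_simps)
  finally show ?case unfolding t_def .
qed simp

text \<open>Each of the \<open>n - 1 choose m\<close> possible sets of size \<open>m\<close> is
  attained by the same number of permutations.\<close>

lemma card_fix_set_count: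
  assumes "m \<le> n - 1"
  shows "card {p \<in> perms n. card (fix_set n p) = m} =
    real (n - 1 choose m) *
      (\<Sum>j\<le>n - 1 - m. (-1) ^ j * real (n - 1 - m choose j) * fact (n - (m + j)))"
proof -
  let ?c = "\<Sum>j\<le>n - 1 - m. (-1) ^ j * int (n - 1 - m choose j) * fact (n - (m + j))"
  have "int (card {p \<in> perms n. card (fix_set n p) = m}) =
      (\<Sum>S \<in> {S. S \<subseteq> {1..n - 1} \<and> card S = m}. int (card {p \<in> perms n. fix_set n p = S}))"
    by (subst card_card_vimage_eq[where U = "{1..n - 1}"]) (simp_all add: finite_perms fix_set_subset del: One_nat_def)
  also have "\<dots> = (\<Sum>S \<in> {S. S \<subseteq> {1..n - 1} \<and> card S = m}. ?c)"
    by (rule sum.cong[OF refl]) (use card_fix_set_eq in blast)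
  also have "\<dots> = int (n - 1 choose m) * ?c"
    by (simp add: n_subsets)
  finally have "real_of_int (int (card {p \<in> perms n. card (fix_set n p) = m})) =
      real_of_int (int (n - 1 choose m) * ?c)" by (rule arg_cong)
  then show ?thesis by simp
qed

lemma fix_set_count_formula:
  assumes "n \<ge> 1" "m \<le> n - 1"
  shows "card {p \<in> perms n. card (fix_set n p) = m} / fact n =
     (1 / fact m * (\<Sum>k=0..n - m. (-1) ^ k / fact k)) * ((real n - real m) / real n)
   + (1 / fact (m + 1) * (\<Sum>k=0..n - m - 1. (-1) ^ k / fact k)) * ((real m + 1) / real n)"
proof -
  \<comment> \<open>With \<open>n = Suc (m + r)\<close> truncated subtraction disappears, and
    \<open>n - m\<close> becomes \<open>Suc r\<close>.\<close>
  define r where "r = n - 1 - m"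
  have n: "n = Suc (m + r)" using assms by (simp add: r_def)
  let ?e = "\<lambda>r. \<Sum>k\<le>r. (-1) ^ k / fact k :: real"
  have binom_fact: "real (r choose j) * fact (Suc r - j) = fact r * ((real r + 1 - real j) / fact j)"
    if "j \<le> r" for j
    using that by (simp add: binomial_fact Suc_diff_le field_simps of_nat_diff)
  have "card {p \<in> perms n. card (fix_set n p) = m} =
      real (m + r choose m) * (\<Sum>j\<le>r. (-1) ^ j * real (r choose j) * fact (Suc r - j))"
    using card_fix_set_count[OF assms(2)] by (simp add: n)
  also have "(\<Sum>j\<le>r. (-1) ^ j * real (r choose j) * fact (Suc r - j)) =
      fact r * (\<Sum>j\<le>r. (-1) ^ j / fact j * (real r + 1 - real j))"
    unfolding sum_distrib_left by (rule sum.cong) (simp_all add: binom_fact mult.assoc)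
  also have "\<dots> = fact r * ((real r + 1) * ?e (Suc r) + ?e r)"
    by (simp only: sum_alternating_inverse_fact)
  also have "real (m + r choose m) = fact (m + r) / (fact m * fact r)"
    by (simp add: binomial_fact)
  finally have "card {p \<in> perms n. card (fix_set n p) = m} / fact n =
      ((real r + 1) * ?e (Suc r) + ?e r) / (fact m * real n)"
    by (simp add: n del: sum.atMost_Suc)
  also have "\<dots> = (1 / fact m * ?e (Suc r)) * ((real r + 1) / real n) + 1 / fact m * ?e r / real n"
    by (simp add: add_divide_distrib[of "(real r + 1) * ?e (Suc r)"] mult.commute del: sum.atMost_Suc)
  \<comment> \<open>Expanding by \<open>m + 1\<close> gives the second term its announced
    shape.\<close>
  also have "1 / fact m * ?e r / real n = (1 / fact (m + 1) * ?e r) * ((real m + 1) / real n)"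
    by (simp add: add.commute)
  finally show ?thesis
    by (simp add: n atMost_atLeast0 add.commute del: sum.atMost_Suc)
qed

section \<open>From counts to probabilities\<close>

lemma uniform_random_perm_prob:
  assumes "uniform_random_perm n M X"
  shows "\<P>(\<omega> in M. P (X \<omega>)) = card {p \<in> perms n. P p} / fact n"
proof -
  let ?N = "count_space (perms n)"
  have X: "X \<in> measurable M ?N" and D: "distr M ?N X = uniform_count_measure (perms n)"
    using assms by (auto simp: uniform_random_perm_def)
  have "{\<omega> \<in> space M. P (X \<omega>)} = X -` {p \<in> perms n. P p} \<inter> space M"
    using measurable_space[OF X] by auto
  then have "\<P>(\<omega> in M. P (X \<omega>)) = measure (distr M ?N X) {p \<in> perms n. P p}"
    by (simp add: measure_distr[OF X])
  then show ?thesis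
    by (simp add: D measure_uniform_count_measure finite_perms card_perms)
qed

theorem theorem1p1:
  fixes n :: nat and M :: "'a measure" and X :: "'a \<Rightarrow> nat \<Rightarrow> nat"
  assumes "n \<ge> 1"
    and "uniform_random_perm n M X"
  shows "distr M (count_space (Pow {1..n - 1})) (\<lambda>\<omega>. succ_set n (X \<omega>)) =
         distr M (count_space (Pow {1..n - 1})) (\<lambda>\<omega>. fix_set n (X \<omega>))
    \<and> (\<forall>S. S \<subseteq> {1..n - 1} \<longrightarrow>
           \<P>(\<omega> in M. succ_set n (X \<omega>) = S) = \<P>(\<omega> in M. fix_set n (X \<omega>) = S))
    \<and> (\<forall>m::nat. m \<le> n - 1 \<longrightarrow>
           \<P>(\<omega> in M. card (succ_set n (X \<omega>)) = m) = \<P>(\<omega> in M. card (fix_set n (X \<omega>)) = m)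
         \<and> \<P>(\<omega> in M. card (fix_set n (X \<omega>)) = m) =
             (1 / fact m * (\<Sum>k=0..n - m. (-1) ^ k / fact k)) * ((real n - real m) / real n)
           + (1 / fact (m + 1) * (\<Sum>k=0..n - m - 1. (-1) ^ k / fact k)) * ((real m + 1) / real n))"
proof (intro conjI allI impI)
  let ?C = "count_space (Pow {1..n - 1})"
  interpret prob_space M using assms(2) by (simp add: uniform_random_perm_def)
  have X: "X \<in> measurable M (count_space (perms n))"
    using assms(2) by (simp add: uniform_random_perm_def)
  have meas: "(\<lambda>\<omega>. succ_set n (X \<omega>)) \<in> measurable M ?C" "(\<lambda>\<omega>. fix_set n (X \<omega>)) \<in> measurable M ?C"
    by (rule measurable_compose[OF X]; auto simp: succ_set_def fix_set_def)+
  have eq: "\<P>(\<omega> in M. succ_set n (X \<omega>) = S) = \<P>(\<omega> in M. fix_set n (X \<omega>) = S)"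
    if "S \<subseteq> {1..n - 1}" for S
    using card_succ_set_eq_card_fix_set[OF that]
    by (simp add: uniform_random_perm_prob[OF assms(2), where P = "\<lambda>p. succ_set n p = S"]
        uniform_random_perm_prob[OF assms(2), where P = "\<lambda>p. fix_set n p = S"])
  then show "\<P>(\<omega> in M. succ_set n (X \<omega>) = S) = \<P>(\<omega> in M. fix_set n (X \<omega>) = S)"
    if "S \<subseteq> {1..n - 1}" for S using that .
  show "distr M ?C (\<lambda>\<omega>. succ_set n (X \<omega>)) = distr M ?C (\<lambda>\<omega>. fix_set n (X \<omega>))"
  \<comment> \<open>The target space is finite and discrete, so agreement on singletons
    suffices.\<close>
  proof (rule measure_eqI_finite)
    fix S assume "S \<in> Pow {1..n - 1}"
    then show "emeasure (distr M ?C (\<lambda>\<omega>. succ_set n (X \<omega>))) {S}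
        = emeasure (distr M ?C (\<lambda>\<omega>. fix_set n (X \<omega>))) {S}"
      using eq[of S] meas
      by (simp add: emeasure_distr emeasure_eq_measure vimage_def Int_def conj_commute)
  qed simp_all
  fix m assume m: "m \<le> n - 1"
  have "card {p \<in> perms n. card (succ_set n p) = m} = card {p \<in> perms n. card (fix_set n p) = m}"
    by (simp add: card_card_vimage_eq[where U = "{1..n - 1}"] finite_perms fix_set_subset
        succ_set_subset card_succ_set_eq_card_fix_set del: One_nat_def)
  then show "\<P>(\<omega> in M. card (succ_set n (X \<omega>)) = m) = \<P>(\<omega> in M. card (fix_set n (X \<omega>)) = m)"
    by (simp add: uniform_random_perm_prob[OF assms(2), where P = "\<lambda>p. card (succ_set n p) = m"]
        uniform_random_perm_prob[OF assms(2), where P = "\<lambda>p. card (fix_set n p) = m"])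
  show "\<P>(\<omega> in M. card (fix_set n (X \<omega>)) = m) =
             (1 / fact m * (\<Sum>k=0..n - m. (-1) ^ k / fact k)) * ((real n - real m) / real n)
           + (1 / fact (m + 1) * (\<Sum>k=0..n - m - 1. (-1) ^ k / fact k)) * ((real m + 1) / real n)"
    using fix_set_count_formula[OF assms(1) m]
    by (simp only: uniform_random_perm_prob[OF assms(2), where P = "\<lambda>p. card (fix_set n p) = m"])
qed

end
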